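(* Let $d\ge 2$ be an integer and let $G$ be a $\{K_{d,d},P_4\}$-free graph. Then $\mathsf{tree}\text{-}\alpha(G)\le d-1$.
   Context: Graphs are finite and simple; $G$ is $\{H_1,H_2\}$-free if it has no induced subgraph isomorphic to $H_1$ or $H_2$. $K_{d,d}$ is the complete bipartite graph with both sides of size $d$, $P_4$ the path on 4 vertices. A tree decomposition of $G$ is a pair $(T,\beta)$ with $T$ a tree and $\beta:V(T)\to 2^{V(G)}$ such that every vertex lies in some bag, every edge has both endpoints in some bag, and for each vertex the nodes whose bags contain it induce a subtree. Its independence number is $\max_t\alpha(G[\beta(t)])$; $\mathsf{tree}\text{-}\alpha(G)$ is the minimum independence number over all tree decompositions of $G$. *)

theory Defs
  imports "Graph_Theory.Graph_Theory"
begin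

text \<open>
  Finite simple graphs are the symmetric digraphs without loops and parallel arcs of
  Graph_Theory (locale \<open>graph\<close>): an edge is a pair of opposite arcs. Induced subgraphs
  (\<open>induced_subgraph\<close>, \<open>G \<restriction> S\<close>) and isomorphism (\<open>digraph_iso\<close>) are those of that entry.
\<close>

section \<open>Forbidden induced subgraphs\<close>

definition complete_bipartite_graph :: "nat \<Rightarrow> nat \<Rightarrow> (nat, nat \<times> nat) pre_digraph" where
  "complete_bipartite_graph m n = with_proj
     \<lparr>pverts = {..<m + n},
      parcs = {..<m} \<times> {m..<m + n} \<union> {m..<m + n} \<times> {..<m}\<rparr>"

definition path_graph :: "nat \<Rightarrow> (nat, nat \<times> nat) pre_digraph" where
  "path_graph n = with_proj
     \<lparr>pverts = {..<n},
      parcs = {(i, j). i < n \<and> j < n \<and> (j = Suc i \<or> i = Suc j)}\<rparr>"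

definition induced_free :: "('h, 'i) pre_digraph set \<Rightarrow> ('a, 'b) pre_digraph \<Rightarrow> bool" where
  "induced_free \<H> G \<longleftrightarrow>
     (\<forall>H\<in>\<H>. \<not> (\<exists>H'. induced_subgraph H' G \<and> digraph_iso H' H))"

lemma complete_bipartite_graph:
  "complete_bipartite_digraph m n (complete_bipartite_graph m n)"
  unfolding complete_bipartite_graph_def complete_bipartite_digraph_pair_def
  by (rule conjI, simp, rule exI[of _ "{..<m}"], rule exI[of _ "{m..<m + n}"]) auto

lemma graph_path_graph: "graph (path_graph n)"
proof -
  have "finite {(i, j). i < n \<and> j < n \<and> (j = Suc i \<or> i = Suc j)}"
    by (rule finite_subset[of _ "{..<n} \<times> {..<n}"]) auto
  then show ?thesis
    unfolding path_graph_def
    by unfold_locales (auto simp: symmetric_def arc_to_ends_def sym_def)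
qed


section \<open>Independence number\<close>

definition independent_set :: "('a, 'b) pre_digraph \<Rightarrow> 'a set \<Rightarrow> bool" where
  "independent_set G S \<longleftrightarrow> S \<subseteq> verts G \<and> (\<forall>u\<in>S. \<forall>v\<in>S. \<not> u \<rightarrow>\<^bsub>G\<^esub> v)"

definition independence_number :: "('a, 'b) pre_digraph \<Rightarrow> nat" where
  "independence_number G = Max (card ` {S. independent_set G S})"


section \<open>Trees and tree decompositions\<close>

text \<open>
  The predicates \<open>forest\<close> and \<open>tree\<close> of Graph_Theory exclude directed cycles. They do not describe
  undirected trees: in a symmetric digraph, every edge traversed back and forth is a cycle of
  length 2. A closed walk counted by \<open>cycle\<close> with at least 3 arcs is a cycle of the simple graph.
  As \<open>connected\<close> requires a vertex, trees are nonempty.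
\<close>

definition is_tree :: "('t, 'e) pre_digraph \<Rightarrow> bool" where
  "is_tree T \<longleftrightarrow> graph T \<and> Digraph_Component.connected T \<and>
     \<not> (\<exists>p. pre_digraph.cycle T p \<and> 3 \<le> length p)"

definition tree_decomposition ::
  "('a, 'b) pre_digraph \<Rightarrow> ('t, 'e) pre_digraph \<Rightarrow> ('t \<Rightarrow> 'a set) \<Rightarrow> bool" where
  "tree_decomposition G T \<beta> \<longleftrightarrow>
     is_tree T \<and>
     (\<forall>t\<in>verts T. \<beta> t \<subseteq> verts G) \<and>
     (\<forall>v\<in>verts G. \<exists>t\<in>verts T. v \<in> \<beta> t) \<and>
     (\<forall>u v. u \<rightarrow>\<^bsub>G\<^esub> v \<longrightarrow> (\<exists>t\<in>verts T. u \<in> \<beta> t \<and> v \<in> \<beta> t)) \<and>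
     (\<forall>v\<in>verts G. is_tree (T \<restriction> {t \<in> verts T. v \<in> \<beta> t}))"

definition decomposition_independence_number ::
  "('a, 'b) pre_digraph \<Rightarrow> ('t, 'e) pre_digraph \<Rightarrow> ('t \<Rightarrow> 'a set) \<Rightarrow> nat" where
  "decomposition_independence_number G T \<beta> =
     Max ((\<lambda>t. independence_number (G \<restriction> \<beta> t)) ` verts T)"

text \<open>
  As trees are finite, it is no restriction to take their nodes from \<open>nat\<close> and their arcs to be
  pairs of nodes.
\<close>

definition tree_alpha :: "('a, 'b) pre_digraph \<Rightarrow> nat" where
  "tree_alpha G = (LEAST k. \<exists>(T :: nat pair_pre_digraph) \<beta>.
     tree_decomposition G (with_proj T) \<beta> \<and>
     k = decomposition_independence_number G (with_proj T) \<beta>)"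

text \<open>
  The minimum is over a nonempty set: all vertices may be put into the only bag of a one-node tree.
\<close>

lemma is_tree_singleton: "is_tree (with_proj \<lparr>pverts = {t}, parcs = {}\<rparr>)" (is "is_tree ?T")
proof -
  interpret graph ?T
    by unfold_locales (auto simp: symmetric_def sym_def)
  have "Digraph_Component.connected ?T"
    by (auto simp: connected_def strongly_connected_def mk_symmetric_def reachable_def)
  moreover have "\<not> cycle p" for p
    by (cases p) (auto simp: cycle_def awalk_def)
  ultimately show ?thesis
    using graph_axioms by (auto simp: is_tree_def)
qed

lemma tree_decomposition_single_bag:
  assumes "graph G"
  shows "tree_decomposition G (with_proj \<lparr>pverts = {t}, parcs = {}\<rparr>) (\<lambda>_. verts G)"
proof -
  interpret graph G by fact
  let ?T = "with_proj \<lparr>pverts = {t}, parcs = {}\<rparr>"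
  have "?T \<restriction> {t} = ?T"
    by (simp add: induce_subgraph_def with_proj_def)
  then have "is_tree (?T \<restriction> {t})"
    using is_tree_singleton[of t] by (simp only:)
  then have "is_tree (?T \<restriction> {s \<in> verts ?T. v \<in> verts G})" if "v \<in> verts G" for v
    using that by simp
  moreover have "u \<in> verts G \<and> v \<in> verts G" if "u \<rightarrow>\<^bsub>G\<^esub> v" for u v
    using that by (rule reachableE) auto
  ultimately show ?thesis
    using is_tree_singleton[of t] unfolding tree_decomposition_def by simp
qed

lemma tree_alpha_attained:
  assumes "graph G"
  obtains T :: "nat pair_pre_digraph" and \<beta> where
    "tree_decomposition G (with_proj T) \<beta>"
    "decomposition_independence_number G (with_proj T) \<beta> = tree_alpha G"
proof -
  have "\<exists>k (T :: nat pair_pre_digraph) \<beta>. tree_decomposition G (with_proj T) \<beta> \<and>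
      k = decomposition_independence_number G (with_proj T) \<beta>"
    by (intro exI conjI) (rule tree_decomposition_single_bag[OF assms], rule refl)
  from LeastI_ex[OF this, folded tree_alpha_def] show ?thesis
    by (elim exE conjE) (rule that, simp_all only:)
qed

end

theory Submission
  imports Defs
begin

text \<open>
  A \<open>P\<^sub>4\<close>-free graph on at least two vertices is disconnected or has a disconnected
  complement (Seinsche), so one can argue by induction on the vertex set. Decompositions of
  two graphs without edges between them are glued along an extra tree edge. If instead \<open>A\<close> and
  \<open>B\<close> are completely joined, every independent set lies in \<open>A\<close> or in \<open>B\<close>. As \<open>K\<^sub>d\<^sub>,\<^sub>d\<close> is
  forbidden, one side, say \<open>A\<close>, has no independent set of size \<open>d\<close>; adding \<open>A\<close> to all bags of a
  decomposition of \<open>B\<close> then keeps the bound.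
\<close>


section \<open>Splitting graphs without induced four-vertex paths\<close>

text \<open>Graphs are bare relations in the combinatorial part, so that a lemma about
  \<open>E\<close> can also be applied to its complement \<open>compl_rel E\<close>.\<close>

definition induced_P4 :: "('a \<Rightarrow> 'a \<Rightarrow> bool) \<Rightarrow> 'a \<Rightarrow> 'a \<Rightarrow> 'a \<Rightarrow> 'a \<Rightarrow> bool" where
  "induced_P4 E a b c d \<longleftrightarrow> distinct [a, b, c, d] \<and> E a b \<and> E b c \<and> E c d \<and>
     \<not> E a c \<and> \<not> E a d \<and> \<not> E b d"

definition P4_free :: "('a \<Rightarrow> 'a \<Rightarrow> bool) \<Rightarrow> 'a set \<Rightarrow> bool" where
  "P4_free E V \<longleftrightarrow> (\<forall>a\<in>V. \<forall>b\<in>V. \<forall>c\<in>V. \<forall>d\<in>V. \<not> induced_P4 E a b c d)"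

text \<open>The parameter \<open>R\<close> unites the two ways to decompose a cograph:
  \<open>splits E\<close> is a join, and \<open>splits (compl_rel E)\<close> is a disjoint union
  without edges across.\<close>

definition splits :: "('a \<Rightarrow> 'a \<Rightarrow> bool) \<Rightarrow> 'a set \<Rightarrow> 'a set \<Rightarrow> 'a set \<Rightarrow> bool" where
  "splits R V A B \<longleftrightarrow> A \<noteq> {} \<and> B \<noteq> {} \<and> A \<inter> B = {} \<and> A \<union> B = V \<and> (\<forall>a\<in>A. \<forall>b\<in>B. R a b)"

definition compl_rel :: "('a \<Rightarrow> 'a \<Rightarrow> bool) \<Rightarrow> 'a \<Rightarrow> 'a \<Rightarrow> bool" where
  "compl_rel E u v \<longleftrightarrow> u \<noteq> v \<and> \<not> E u v"

lemma symp_compl_rel: "symp E \<Longrightarrow> symp (compl_rel E)"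
  by (auto simp: symp_def compl_rel_def)

lemma compl_rel_compl_rel: "irreflp E \<Longrightarrow> compl_rel (compl_rel E) = E"
  by (auto simp: compl_rel_def fun_eq_iff irreflp_def)

text \<open>The path on four vertices is self-complementary.\<close>

lemma P4_free_compl_rel:
  assumes "symp E" "P4_free E V"
  shows "P4_free (compl_rel E) V"
  unfolding P4_free_def
proof (intro ballI notI)
  fix a b c d assume V: "a \<in> V" "b \<in> V" "c \<in> V" "d \<in> V" and "induced_P4 (compl_rel E) a b c d"
  then have "induced_P4 E b d a c"
    using assms(1) by (auto simp: induced_P4_def compl_rel_def symp_def)
  then show False using assms(2) V by (auto simp: P4_free_def)
qed

lemma P4_free_subset: "P4_free E V \<Longrightarrow> U \<subseteq> V \<Longrightarrow> P4_free E U"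
  unfolding P4_free_def by blast

lemma splits_sym: "symp R \<Longrightarrow> splits R V A B \<Longrightarrow> splits R V B A"
  by (auto simp: splits_def symp_def)

text \<open>
  Let \<open>C\<close> be the component of \<open>x\<close> among the non-neighbours of \<open>v\<close>. An edge leaving \<open>C\<close>
  ends in a neighbour of \<open>v\<close>, which together with a neighbour of \<open>v\<close> in \<open>B\<close> yields an induced path.
\<close>

lemma split_insert_nonneighbour:
  assumes E: "symp E" "irreflp E" and free: "P4_free E (insert v V)" and v: "v \<notin> V"
    and AB: "splits (compl_rel E) V A B" and x: "x \<in> A" "\<not> E v x"
  shows "\<exists>A B. splits (compl_rel E) (insert v V) A B"
proof (cases "\<exists>w\<in>B. E v w")
  \<comment> \<open>Without neighbours in \<open>B\<close>, the new vertex simply goes to the side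
    of \<open>A\<close>.\<close>
  case False
  then have "splits (compl_rel E) (insert v V) (insert v A) B"
    using AB v by (auto simp: splits_def compl_rel_def)
  then show ?thesis by blast
next
  case True
  then obtain w where w: "w \<in> B" "E v w" by blast
  \<comment> \<open>Only the end \<open>b\<close> of a step has to avoid the neighbours of
    \<open>v\<close>: the start \<open>x\<close> avoids them by assumption, and every later start is
    the end of an earlier step.\<close>
  define R where "R = {(a, b). a \<in> V \<and> b \<in> V \<and> \<not> E v b \<and> E a b}"
  define C where "C = {z. (x, z) \<in> R\<^sup>*}"
  have sym: "E a b \<Longrightarrow> E b a" for a b
    using E(1) by (auto dest: sympD)
  have C: "z \<in> A \<and> \<not> E v z" if "z \<in> C" for z
  proof -
    from that have "(x, z) \<in> R\<^sup>*" by (simp add: C_def)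
    then show ?thesis
    proof induction
      case base
      then show ?case using x by simp
    next
      case (step y z)
      then show ?case using AB by (auto simp: R_def splits_def compl_rel_def)
    qed
  qed
  have "\<not> E z y" if z: "z \<in> C" and y: "y \<in> insert v V - C" for z y
  proof
    assume zy: "E z y"
    have "y \<noteq> v" using C[OF z] zy sym by blast
    then have yV: "y \<in> V" using y by simp
    have zA: "z \<in> A" "\<not> E v z" using C[OF z] by auto
    have "E v y"
    proof (rule ccontr)
      assume "\<not> E v y"
      then have "(z, y) \<in> R" using zA yV zy AB by (auto simp: R_def splits_def)
      then have "y \<in> C" using z by (auto simp: C_def intro: rtrancl.rtrancl_into_rtrancl)
      then show False using y by simp
    qed
    moreover have yA: "y \<in> A" using zA zy yV AB by (auto simp: splits_def compl_rel_def)
    moreover have "v \<notin> A" "v \<notin> B" "w \<notin> A" using v w AB by (auto simp: splits_def)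
    moreover have "\<not> E w a" if "a \<in> A" for a
      using that AB w sym[of w a] by (auto simp: splits_def compl_rel_def)
    moreover have "y \<noteq> z" using E(2) zy by (auto simp: irreflp_def)
    \<comment> \<open>Here \<open>w\<close> is in \<open>B\<close> while \<open>y\<close> and
      \<open>z\<close> are in \<open>A\<close>, so \<open>w\<close> sees neither of them;
      \<open>z\<close> is in \<open>C\<close> and hence not adjacent to \<open>v\<close>.\<close>
    ultimately have "induced_P4 E w v y z"
      unfolding induced_P4_def using zA w sym[OF zy] sym[OF w(2)] by auto
    then show False
      using free w zA yA AB by (auto simp: P4_free_def splits_def)
  qed
  moreover have "x \<in> C" by (simp add: C_def)
  moreover have "C \<subseteq> V" using C AB by (auto simp: splits_def)
  ultimately have "splits (compl_rel E) (insert v V) C (insert v V - C)"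
    using v by (auto simp: splits_def compl_rel_def)
  then show ?thesis by blast
qed

text \<open>A vertex adjacent to all of \<open>V\<close> is joined to \<open>V\<close>. Otherwise it
  has a non-neighbour in \<open>A\<close> or in \<open>B\<close>, and the preceding lemma applies
  after swapping the sides if necessary.\<close>

lemma split_insert:
  assumes E: "symp E" "irreflp E" and free: "P4_free E (insert v V)" and v: "v \<notin> V"
    and AB: "splits (compl_rel E) V A B"
  shows "\<exists>A B. splits (compl_rel E) (insert v V) A B \<or> splits E (insert v V) A B"
proof (cases "\<forall>x\<in>V. E v x")
  case True
  then have "splits E (insert v V) {v} V"
    using AB v by (auto simp: splits_def)
  then show ?thesis by blast
next
  case False
  then obtain x where "x \<in> A \<or> x \<in> B" "\<not> E v x"
    using AB by (auto simp: splits_def)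
  then show ?thesis
    using split_insert_nonneighbour[OF E free v AB]
      split_insert_nonneighbour[OF E free v splits_sym[OF symp_compl_rel[OF E(1)] AB]] by blast
qed

text \<open>Seinsche's theorem, by adding one vertex at a time. \<open>split_insert\<close> treats a
  disconnected \<open>V\<close>; a join is disconnected in the complement, which is again
  \<open>P4_free\<close>.\<close>

lemma P4_free_splits:
  assumes E: "symp E" "irreflp E" and "finite V" "2 \<le> card V" "P4_free E V"
  shows "\<exists>A B. splits (compl_rel E) V A B \<or> splits E V A B"
  using assms(3-)
proof induction
  case empty
  then show ?case by simp
next
  case (insert v V)
  show ?case
  proof (cases "2 \<le> card V")
    case False
    with insert have "card V = 1" by simp
    then obtain x where "V = {x}" by (rule card_1_singletonE)
    with insert have "splits (compl_rel E) (insert v V) {v} {x} \<or> splits E (insert v V) {v} {x}"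
      by (auto simp: splits_def compl_rel_def)
    then show ?thesis by blast
  next
    case True
    have "P4_free E V" using insert.prems by (auto intro: P4_free_subset)
    from insert.IH[OF True this] obtain A B
      where "splits (compl_rel E) V A B \<or> splits E V A B" by blast
    then show ?thesis
    proof
      assume "splits (compl_rel E) V A B"
      then show ?thesis using split_insert[OF E] insert by blast
    next
      have irr: "irreflp (compl_rel E)" by (auto simp: irreflp_def compl_rel_def)
      assume "splits E V A B"
      then show ?thesis
        \<comment> \<open>With \<open>compl_rel E\<close> in place of \<open>E\<close>, the double
          complement collapses to \<open>E\<close> and the two disjuncts of the conclusion trade
          places.\<close>
        using split_insert[OF symp_compl_rel[OF E(1)] irr, unfolded compl_rel_compl_rel[OF E(2)],
            OF P4_free_compl_rel[OF E(1)]] insert by blast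
    qed
  qed
qed


section \<open>Trees from parent functions\<close>

text \<open>An edge needs \<open>p i < i\<close> and both ends in \<open>V\<close>. So
  \<open>p\<close> may be arbitrary at a root, and the same \<open>p\<close> still serves after
  restriction to a smaller node set.\<close>

definition parent_graph :: "nat set \<Rightarrow> (nat \<Rightarrow> nat) \<Rightarrow> nat pair_pre_digraph" where
  "parent_graph V p = \<lparr>pverts = V,
     parcs = {(i, j). i \<in> V \<and> j \<in> V \<and> (p i < i \<and> j = p i \<or> p j < j \<and> i = p j)}\<rparr>"

lemma induce_subgraph_parent_graph:
  "S \<subseteq> V \<Longrightarrow> with_proj (parent_graph V p) \<restriction> S = with_proj (parent_graph S p)"
  by (auto simp: induce_subgraph_def with_proj_def parent_graph_def)

text \<open>The largest node on a cycle would have its parent as both neighbours.\<close>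

lemma no_long_cycle_parent_graph:
  assumes cyc: "pre_digraph.cycle (with_proj (parent_graph V p)) es"
  shows "length es < 3"
proof (rule ccontr)
  define T where "T = with_proj (parent_graph V p)"
  assume "\<not> length es < 3"
  then have n: "3 \<le> length es" by simp
  from cyc obtain u where walk: "pre_digraph.awalk T u es u"
    and dist: "distinct (tl (pre_digraph.awalk_verts T u es))"
    unfolding pre_digraph.cycle_def T_def by blast
  from walk have cas: "pre_digraph.cas T u es u" and arcs: "set es \<subseteq> arcs T"
    by (auto simp: pre_digraph.awalk_def)
  have adj: "b = p a" if "(a, b) \<in> arcs T" "b \<le> a" for a b
    using that by (auto simp: T_def parent_graph_def)
  have adj': "a = p b" if "(a, b) \<in> arcs T" "a \<le> b" for a b
    using that by (auto simp: T_def parent_graph_def)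
  \<comment> \<open>The tail of the vertex list of a walk is the list of the heads of its
    arcs.\<close>
  have heads: "distinct (map snd es)"
    using dist n unfolding pre_digraph.awalk_verts_conv'[OF cas]
    by (auto simp: T_def split: if_splits)
  have cas_next: "fst (fs ! Suc k) = snd (fs ! k)"
    if "pre_digraph.cas T a fs b" "Suc k < length fs" for a b fs k
    using that
  proof (induction fs arbitrary: a k)
    case Nil
    then show ?case by simp
  next
    case (Cons e fs)
    then show ?case
      by (cases k; cases fs) (auto simp: T_def pre_digraph.cas.simps)
  qed
  have cas_last: "snd (last fs) = b" if "pre_digraph.cas T a fs b" "fs \<noteq> []" for a b fs
    using that
    by (induction fs arbitrary: a) (auto simp: T_def pre_digraph.cas.simps)
  have "fst (es ! 0) = u"
    using cas n by (cases es) (auto simp: T_def pre_digraph.cas.simps)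
  moreover have "es \<noteq> []" using n by auto
  ultimately have wrap: "fst (es ! 0) = snd (es ! (length es - 1))"
    using cas_last[OF cas] by (simp add: last_conv_nth)
  define M where "M = Max ((\<lambda>l. snd (es ! l)) ` {..<length es})"
  have "M \<in> (\<lambda>l. snd (es ! l)) ` {..<length es}"
    unfolding M_def using n by (intro Max_in) (auto simp: lessThan_empty_iff)
  then obtain k where k: "k < length es" "snd (es ! k) = M" by auto
  have max: "snd (es ! l) \<le> snd (es ! k)" if "l < length es" for l
    using that unfolding k(2) M_def by (intro Max_ge) auto
  \<comment> \<open>The arcs at \<open>i\<close> and \<open>j\<close> are the cyclic predecessor and
    successor of the arc at \<open>k\<close>, which enters the largest node
    \<open>M\<close>.\<close>
  define i where "i = (if k = 0 then length es - 1 else k - 1)"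
  define j where "j = (if Suc k = length es then 0 else Suc k)"
  \<comment> \<open>On a closed walk with two arcs, \<open>i\<close> and \<open>j\<close> would
    coincide; length at least 3 separates them.\<close>
  have ij: "i < length es" "j < length es" "i \<noteq> j"
    using n k by (auto simp: i_def j_def)
  have "fst (es ! k) = snd (es ! i)"
    using cas_next[OF cas, of i] wrap k by (auto simp: i_def)
  moreover have "fst (es ! j) = snd (es ! k)"
  proof (cases "Suc k = length es")
    case True
    then have "length es - 1 = k" by simp
    then show ?thesis using True wrap by (simp add: j_def)
  next
    case False
    then show ?thesis using cas_next[OF cas, of k] k(1) by (simp add: j_def)
  qed
  moreover have "es ! k \<in> arcs T" "es ! j \<in> arcs T"
    using arcs ij k by auto
  ultimately have "(snd (es ! i), snd (es ! k)) \<in> arcs T" "(snd (es ! k), snd (es ! j)) \<in> arcs T"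
    by (metis prod.collapse)+
  then have "snd (es ! i) = p (snd (es ! k))" "snd (es ! j) = p (snd (es ! k))"
    using adj adj' max ij by blast+
  then show False
    using ij nth_eq_iff_index_eq[OF heads, of i j] by simp
qed

text \<open>Parents decrease, so strong induction links every node to \<open>r\<close> in both
  directions. The assumptions force \<open>r\<close> to be the least node of
  \<open>V\<close>.\<close>

lemma is_tree_parent_graph:
  assumes fin: "finite V" and r: "r \<in> V" and p: "\<And>i. i \<in> V \<Longrightarrow> i \<noteq> r \<Longrightarrow> p i \<in> V \<and> p i < i"
  shows "is_tree (with_proj (parent_graph V p))" (is "is_tree ?T")
proof -
  have "finite {(i, j). i \<in> V \<and> j \<in> V \<and> (p i < i \<and> j = p i \<or> p j < j \<and> i = p j)}"
    by (rule finite_subset[of _ "V \<times> V"]) (use fin in auto)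
  then interpret graph ?T
    by unfold_locales (use fin in \<open>auto simp: parent_graph_def arc_to_ends_def symmetric_def sym_def\<close>)
  have root: "r \<rightarrow>\<^sup>*\<^bsub>?T\<^esub> i \<and> i \<rightarrow>\<^sup>*\<^bsub>?T\<^esub> r" if "i \<in> V" for i
    using that
  proof (induction i rule: less_induct)
    case (less i)
    show ?case
    proof (cases "i = r")
      case True
      then show ?thesis using r reachable_refl[of r] by (simp add: parent_graph_def)
    next
      case False
      with p[OF less.prems] less.IH have "r \<rightarrow>\<^sup>*\<^bsub>?T\<^esub> p i" "p i \<rightarrow>\<^sup>*\<^bsub>?T\<^esub> r" by auto
      moreover from False p[OF less.prems] less.prems
      have "p i \<rightarrow>\<^bsub>?T\<^esub> i" "i \<rightarrow>\<^bsub>?T\<^esub> p i" by (auto simp: parent_graph_def)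
      ultimately show ?thesis
        by (meson reachable_adj_trans adj_reachable_trans)
    qed
  qed
  have "strongly_connected ?T"
    unfolding strongly_connected_def
  proof (intro conjI ballI)
    show "verts ?T \<noteq> {}" using r by (auto simp: parent_graph_def)
    fix u v assume "u \<in> verts ?T" "v \<in> verts ?T"
    then have "u \<in> V" "v \<in> V" by (auto simp: parent_graph_def)
    then show "u \<rightarrow>\<^sup>*\<^bsub>?T\<^esub> v" using root reachable_trans by blast
  qed
  then have "Digraph_Component.connected ?T"
    by (auto simp: connected_def strongly_connected_def reachable_mk_symmetric_eq[OF sym_arcs])
  then show ?thesis
    using no_long_cycle_parent_graph graph_axioms by (fastforce simp: is_tree_def)
qed


section \<open>Decompositions along parent functions\<close>

definition indep :: "('a \<Rightarrow> 'a \<Rightarrow> bool) \<Rightarrow> 'a set \<Rightarrow> bool" where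
  "indep E S \<longleftrightarrow> (\<forall>u\<in>S. \<forall>v\<in>S. \<not> E u v)"

text \<open>
  The nodes are \<open>0, \<dots>, n - 1\<close> with root \<open>0\<close>. The nodes whose bags contain \<open>v\<close> induce a subtree
  because all of them except its top node \<open>s\<close> have their parent among them.
\<close>

definition parent_decomposition ::
  "('a \<Rightarrow> 'a \<Rightarrow> bool) \<Rightarrow> 'a set \<Rightarrow> nat \<Rightarrow> nat \<Rightarrow> (nat \<Rightarrow> nat) \<Rightarrow> (nat \<Rightarrow> 'a set) \<Rightarrow> bool" where
  "parent_decomposition E W k n p \<beta> \<longleftrightarrow>
     0 < n \<and>
     (\<forall>t<n. 0 < t \<longrightarrow> p t < t) \<and>
     (\<forall>t<n. \<beta> t \<subseteq> W) \<and>
     (\<forall>u\<in>W. \<forall>v\<in>W. E u v \<longrightarrow> (\<exists>t<n. u \<in> \<beta> t \<and> v \<in> \<beta> t)) \<and>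
     (\<forall>v\<in>W. \<exists>s<n. v \<in> \<beta> s \<and> (\<forall>t<n. v \<in> \<beta> t \<longrightarrow> t \<noteq> s \<longrightarrow> p t < t \<and> v \<in> \<beta> (p t))) \<and>
     (\<forall>t<n. \<forall>S\<subseteq>\<beta> t. indep E S \<longrightarrow> card S \<le> k)"

lemma parent_decomposition_single_bag:
  assumes "\<And>S. S \<subseteq> W \<Longrightarrow> indep E S \<Longrightarrow> card S \<le> k"
  shows "parent_decomposition E W k 1 p (\<lambda>_. W)"
  using assms by (auto simp: parent_decomposition_def)

text \<open>The nodes of the second tree are shifted by \<open>n\<close>, and its root, now
  \<open>n\<close>, becomes a child of the root \<open>0\<close> of the first tree. Since
  \<open>A\<close> and \<open>B\<close> are disjoint, no vertex occurs in the bags of both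
  trees.\<close>

lemma parent_decomposition_union:
  assumes D1: "parent_decomposition E A k n p \<beta>" and D2: "parent_decomposition E B k m q \<gamma>"
    and sym: "symp E" and AB: "splits (compl_rel E) W A B"
  shows "parent_decomposition E W k (n + m)
     (\<lambda>t. if t < n then p t else if t = n then 0 else n + q (t - n))
     (\<lambda>t. if t < n then \<beta> t else \<gamma> (t - n))" (is "parent_decomposition E W k ?n ?p ?b")
proof -
  have pos: "0 < n" "0 < m" and p: "\<And>t. t < n \<Longrightarrow> 0 < t \<Longrightarrow> p t < t" "\<And>t. t < m \<Longrightarrow> 0 < t \<Longrightarrow> q t < t"
    and sub: "\<And>t. t < n \<Longrightarrow> \<beta> t \<subseteq> A" "\<And>t. t < m \<Longrightarrow> \<gamma> t \<subseteq> B"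
    and edge: "\<And>u v. u \<in> A \<Longrightarrow> v \<in> A \<Longrightarrow> E u v \<Longrightarrow> \<exists>t<n. u \<in> \<beta> t \<and> v \<in> \<beta> t"
      "\<And>u v. u \<in> B \<Longrightarrow> v \<in> B \<Longrightarrow> E u v \<Longrightarrow> \<exists>t<m. u \<in> \<gamma> t \<and> v \<in> \<gamma> t"
    and tree: "\<And>v. v \<in> A \<Longrightarrow> \<exists>s<n. v \<in> \<beta> s \<and> (\<forall>t<n. v \<in> \<beta> t \<longrightarrow> t \<noteq> s \<longrightarrow> p t < t \<and> v \<in> \<beta> (p t))"
      "\<And>v. v \<in> B \<Longrightarrow> \<exists>s<m. v \<in> \<gamma> s \<and> (\<forall>t<m. v \<in> \<gamma> t \<longrightarrow> t \<noteq> s \<longrightarrow> q t < t \<and> v \<in> \<gamma> (q t))"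
    and ind: "\<And>t S. t < n \<Longrightarrow> S \<subseteq> \<beta> t \<Longrightarrow> indep E S \<Longrightarrow> card S \<le> k"
      "\<And>t S. t < m \<Longrightarrow> S \<subseteq> \<gamma> t \<Longrightarrow> indep E S \<Longrightarrow> card S \<le> k"
    using D1 D2 by (simp_all add: parent_decomposition_def)
  have W: "W = A \<union> B" "A \<inter> B = {}" and no_edge: "\<And>a b. a \<in> A \<Longrightarrow> b \<in> B \<Longrightarrow> \<not> E a b"
    using AB by (auto simp: splits_def compl_rel_def)
  have no_edge': "\<not> E b a" if "a \<in> A" "b \<in> B" for a b
    using no_edge[OF that] sympD[OF sym] by blast
  have shift: "\<exists>t<n + m. P t" if "t < m" "P (n + t)" for t and P :: "nat \<Rightarrow> bool"
    using that by (intro exI[of _ "n + t"]) auto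
  have cases: "t < n \<or> (\<exists>r<m. t = n + r)" if "t < n + m" for t
    using that by (cases "t < n") (auto intro!: exI[of _ "t - n"])
  show ?thesis
    unfolding parent_decomposition_def
  proof (intro conjI ballI allI impI)
    show "0 < n + m" using pos by simp
    show "?p t < t" if "t < n + m" "0 < t" for t
      using cases[OF that(1)] that(2) p pos by fastforce
    show "?b t \<subseteq> W" if "t < n + m" for t
      using cases[OF that] sub W by fastforce
    show "card S \<le> k" if "t < n + m" "S \<subseteq> ?b t" "indep E S" for t S
      using cases[OF that(1)] that(2,3) ind by fastforce
    show "\<exists>t<n + m. u \<in> ?b t \<and> v \<in> ?b t" if uv: "u \<in> W" "v \<in> W" "E u v" for u v
    proof (cases "u \<in> A")
      case True
      then have "v \<in> A" using no_edge no_edge' uv W by auto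
      with True uv edge(1) obtain t where "t < n" "u \<in> \<beta> t \<and> v \<in> \<beta> t" by blast
      then show ?thesis by (intro exI[of _ t]) auto
    next
      case False
      then have "u \<in> B" "v \<in> B" using no_edge no_edge' uv W by auto
      with uv edge(2) obtain t where "t < m" "u \<in> \<gamma> t \<and> v \<in> \<gamma> t" by blast
      then show ?thesis by (intro shift[of t]) auto
    qed
    show "\<exists>s<n + m. v \<in> ?b s \<and> (\<forall>t<n + m. v \<in> ?b t \<longrightarrow> t \<noteq> s \<longrightarrow> ?p t < t \<and> v \<in> ?b (?p t))"
      if v: "v \<in> W" for v
    proof (cases "v \<in> A")
      case True
      then obtain s where s: "s < n" "v \<in> \<beta> s"
        "\<And>t. t < n \<Longrightarrow> v \<in> \<beta> t \<Longrightarrow> t \<noteq> s \<Longrightarrow> p t < t \<and> v \<in> \<beta> (p t)"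
        using tree(1) by blast
      have "t < n" if "t < n + m" "v \<in> ?b t" for t
        using cases[OF that(1)] that(2) True W sub(2) by fastforce
      then show ?thesis using s by (intro exI[of _ s]) fastforce
    next
      case False
      then have vB: "v \<in> B" using v W by auto
      then obtain s where s: "s < m" "v \<in> \<gamma> s"
        "\<And>t. t < m \<Longrightarrow> v \<in> \<gamma> t \<Longrightarrow> t \<noteq> s \<Longrightarrow> q t < t \<and> v \<in> \<gamma> (q t)"
        using tree(2) by blast
      have "?p t < t \<and> v \<in> ?b (?p t)" if t: "t < n + m" "v \<in> ?b t" "t \<noteq> n + s" for t
      proof -
        from t False sub(1) have "\<not> t < n" by fastforce
        with cases[OF t(1)] obtain r where "r < m" "t = n + r" by blast
        \<comment> \<open>The redirected node \<open>n\<close> causes no trouble: for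
          \<open>r = 0\<close>, the fact \<open>s(3)\<close> would give
          \<open>q 0 < 0\<close>.\<close>
        then show ?thesis using s(3)[of r] t by auto
      qed
      then show ?thesis using s by (intro shift[of s]) auto
    qed
  qed
qed

lemma indep_join_cases:
  assumes "splits E W A B" "S \<subseteq> W" "indep E S"
  shows "S \<subseteq> A \<or> S \<subseteq> B"
  using assms unfolding splits_def indep_def by blast

text \<open>A vertex of \<open>A\<close> lies in every bag, so its subtree is the whole tree. An
  independent subset of an enlarged bag lies in \<open>A\<close> or in the old bag, and both cases
  are bounded by \<open>k\<close>.\<close>

lemma parent_decomposition_join:
  assumes D: "parent_decomposition E B k n p \<beta>" and AB: "splits E W A B"
    and ind: "\<And>S. S \<subseteq> A \<Longrightarrow> indep E S \<Longrightarrow> card S \<le> k"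
  shows "parent_decomposition E W k n p (\<lambda>t. A \<union> \<beta> t)"
proof -
  have D': "0 < n" "\<And>t. t < n \<Longrightarrow> 0 < t \<Longrightarrow> p t < t" "\<And>t. t < n \<Longrightarrow> \<beta> t \<subseteq> B"
    "\<And>u v. u \<in> B \<Longrightarrow> v \<in> B \<Longrightarrow> E u v \<Longrightarrow> \<exists>t<n. u \<in> \<beta> t \<and> v \<in> \<beta> t"
    "\<And>v. v \<in> B \<Longrightarrow> \<exists>s<n. v \<in> \<beta> s \<and> (\<forall>t<n. v \<in> \<beta> t \<longrightarrow> t \<noteq> s \<longrightarrow> p t < t \<and> v \<in> \<beta> (p t))"
    "\<And>t S. t < n \<Longrightarrow> S \<subseteq> \<beta> t \<Longrightarrow> indep E S \<Longrightarrow> card S \<le> k"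
    using D by (simp_all add: parent_decomposition_def)
  have W: "W = A \<union> B" "A \<inter> B = {}" using AB by (auto simp: splits_def)
  show ?thesis
    unfolding parent_decomposition_def
  proof (intro conjI ballI allI impI)
    show "A \<union> \<beta> t \<subseteq> W" if "t < n" for t
      using that D'(3)[of t] W by auto
    show "card S \<le> k" if t: "t < n" "S \<subseteq> A \<union> \<beta> t" "indep E S" for t S
    proof -
      have "S \<subseteq> A \<or> S \<subseteq> B"
        using indep_join_cases[OF AB _ t(3)] t D'(3)[of t] W by blast
      then have "S \<subseteq> A \<or> S \<subseteq> \<beta> t" using t(2) W by blast
      then show ?thesis using ind D'(6) t by blast
    qed
    show "\<exists>t<n. u \<in> A \<union> \<beta> t \<and> v \<in> A \<union> \<beta> t" if uv: "u \<in> W" "v \<in> W" "E u v" for u v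
    proof -
      \<comment> \<open>If one end of an edge is in \<open>A\<close>, any bag containing the other
        end will do. For \<open>w\<close> in \<open>A\<close> this needs that there is a bag at
        all.\<close>
      have covered: "\<exists>t<n. w \<in> A \<union> \<beta> t" if "w \<in> W" for w
        using that D'(1) D'(5)[of w] W(1) by blast
      consider "u \<in> A" | "v \<in> A" | "u \<in> B" "v \<in> B" using uv W(1) by blast
      then show ?thesis
      proof cases
        case 1
        then show ?thesis using covered[OF uv(2)] by blast
      next
        case 2
        then show ?thesis using covered[OF uv(1)] by blast
      next
        case 3
        then show ?thesis using D'(4)[OF 3 uv(3)] by blast
      qed
    qed
    show "\<exists>s<n. v \<in> A \<union> \<beta> s \<and> (\<forall>t<n. v \<in> A \<union> \<beta> t \<longrightarrow> t \<noteq> s \<longrightarrow> p t < t \<and> v \<in> A \<union> \<beta> (p t))"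
      if "v \<in> W" for v
    proof (cases "v \<in> A")
      case True
      \<comment> \<open>The top node of a vertex of \<open>A\<close> is the root
        \<open>0\<close>.\<close>
      then show ?thesis using D'(1,2) by (intro exI[of _ 0]) auto
    next
      case False
      then show ?thesis using D'(5)[of v] that W by auto
    qed
  qed (use D' in auto)
qed

lemma splits_psubset:
  assumes "splits R W A B"
  shows "A \<subset> W" "B \<subset> W"
  using assms by (auto simp: splits_def)

text \<open>The biclique assumption expresses the absence of an induced complete bipartite graph
  with sides of size \<open>k + 1\<close>. It passes to subsets of \<open>W\<close>, so both kinds
  of split allow recursion.\<close>

lemma exists_parent_decomposition:
  assumes E: "symp E" "irreflp E" and k: "1 \<le> k" and "finite W" "P4_free E W"
    and biclique: "\<And>A B. A \<subseteq> W \<Longrightarrow> B \<subseteq> W \<Longrightarrow> indep E A \<Longrightarrow> indep E B \<Longrightarrow> \<forall>a\<in>A. \<forall>b\<in>B. E a b \<Longrightarrow>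
      card A \<le> k \<or> card B \<le> k"
  shows "\<exists>n p \<beta>. parent_decomposition E W k n p \<beta>"
  using assms(4-)
proof (induction W rule: finite_psubset_induct)
  case (psubset W)
  have IH: "\<exists>n p \<beta>. parent_decomposition E B k n p \<beta>" if "B \<subset> W" for B
  proof (rule psubset.IH[OF that])
    show "P4_free E B" using psubset.prems(1) that by (auto intro: P4_free_subset)
  qed (use psubset.prems(2) that in blast)
  show ?case
  proof (cases "2 \<le> card W")
    case False
    \<comment> \<open>With at most one vertex, a single bag suffices because \<open>k\<close> is at
      least 1.\<close>
    then have "card S \<le> k" if "S \<subseteq> W" for S
      using card_mono[OF psubset.hyps that] k by linarith
    then show ?thesis using parent_decomposition_single_bag[of W E k] by blast
  next
    case True
    obtain A B where "splits (compl_rel E) W A B \<or> splits E W A B"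
      using P4_free_splits[OF E psubset.hyps True psubset.prems(1)] by blast
    then show ?thesis
    proof
      assume AB: "splits (compl_rel E) W A B"
      then show ?thesis
        using IH[of A] IH[of B] splits_psubset[OF AB] parent_decomposition_union[OF _ _ E(1) AB] by blast
    next
      assume AB: "splits E W A B"
      have BA: "splits E W B A" using splits_sym[OF E(1) AB] .
      \<comment> \<open>If both sides contained an independent set larger than \<open>k\<close>,
        these two sets would be completely joined, against the biclique assumption.\<close>
      consider "\<forall>S\<subseteq>A. indep E S \<longrightarrow> card S \<le> k" | "\<forall>S\<subseteq>B. indep E S \<longrightarrow> card S \<le> k"
      proof -
        have "card S \<le> k \<or> card S' \<le> k" if "S \<subseteq> A" "S' \<subseteq> B" "indep E S" "indep E S'" for S S'
          using psubset.prems(2)[of S S'] that AB unfolding splits_def by blast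
        then show ?thesis using that by blast
      qed
      then show ?thesis
      proof cases
        case 1
        then show ?thesis
          using IH[of B] splits_psubset[OF AB] parent_decomposition_join[OF _ AB] by blast
      next
        case 2
        then show ?thesis
          using IH[of A] splits_psubset[OF AB] parent_decomposition_join[OF _ BA] by blast
      qed
    qed
  qed
qed


section \<open>Transfer to digraphs\<close>

context graph
begin

lemma symp_dominates: "symp (dominates G)"
  using sym_arcs by (auto simp: symmetric_def symp_def dest: symD)

lemma irreflp_dominates: "irreflp (dominates G)"
  using no_loops by (auto simp: irreflp_def arcs_ends_conv)

text \<open>This replaces isomorphisms of digraphs by a vertex map \<open>f\<close> that preserves
  and reflects adjacency, which is easy to give for concrete \<open>H\<close>.\<close>

lemma induced_free_no_embedding:
  assumes free: "induced_free \<H> G" and H: "with_proj H \<in> \<H>" "pair_wf_digraph H"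
    and inj: "inj_on f (pverts H)" and f: "f ` pverts H \<subseteq> verts G"
    and arcs: "\<And>u v. u \<in> pverts H \<Longrightarrow> v \<in> pverts H \<Longrightarrow> (u, v) \<in> parcs H \<longleftrightarrow> f u \<rightarrow>\<^bsub>G\<^esub> f v"
  shows False
proof -
  interpret H: pair_wf_digraph H by fact
  \<comment> \<open>The isomorphism required goes from the induced subgraph to \<open>H\<close>, so
    it is built from the inverse of \<open>f\<close>. An arc is sent to the pair of images of its
    ends.\<close>
  define g where "g = the_inv_into (pverts H) f"
  have gf: "g (f u) = u" if "u \<in> pverts H" for u
    using the_inv_into_f_f[OF inj that] by (simp add: g_def)
  define hom :: "('a, 'b, 'c, 'c \<times> 'c) digraph_isomorphism" where
    "hom = \<lparr>iso_verts = g, iso_arcs = (\<lambda>e. (g (tail G e), g (head G e))), iso_head = snd, iso_tail = fst\<rparr>"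
  let ?K = "G \<restriction> f ` pverts H"
  have "inj_on g (f ` pverts H)"
    by (rule inj_onI) (auto simp: gf)
  \<comment> \<open>Arcs are determined by their ends because \<open>G\<close> has no parallel
    arcs.\<close>
  moreover have "inj_on (\<lambda>e. (g (tail G e), g (head G e))) (arcs ?K)"
    by (rule inj_onI) (auto simp: gf arc_to_ends_def intro!: no_multi_arcs)
  ultimately have "pre_digraph.digraph_isomorphism ?K hom"
    by (auto simp: pre_digraph.digraph_isomorphism_def hom_def)
  moreover have "g ` f ` pverts H = pverts H"
    by (force simp: gf)
  moreover have "(\<lambda>e. (g (tail G e), g (head G e))) ` arcs ?K = parcs H"
  proof (intro equalityI subsetI)
    fix x assume "x \<in> (\<lambda>e. (g (tail G e), g (head G e))) ` arcs ?K"
    then obtain e u v where "e \<in> arcs G" "u \<in> pverts H" "v \<in> pverts H" "tail G e = f u" "head G e = f v"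
      "x = (g (tail G e), g (head G e))" by auto
    then show "x \<in> parcs H" using arcs[of u v] in_arcs_imp_in_arcs_ends[of e] by (auto simp: gf)
  next
    fix x assume x: "x \<in> parcs H"
    obtain u v where uv: "x = (u, v)" by force
    have "u \<in> pverts H" "v \<in> pverts H" using x uv H.in_arcsD1 H.in_arcsD2 by auto
    moreover from this obtain e where "e \<in> arcs G" "tail G e = f u" "head G e = f v"
      using arcs[of u v] x uv by auto
    ultimately show "x \<in> (\<lambda>e. (g (tail G e), g (head G e))) ` arcs ?K"
      using uv by (intro image_eqI[of _ _ e]) (auto simp: gf)
  qed
  ultimately have "digraph_iso ?K (with_proj H)"
    unfolding digraph_iso_def
    by (intro exI[of _ hom]) (simp add: app_iso_def hom_def with_proj_def)
  moreover have "induced_subgraph ?K G" using f by (rule induced_induce)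
  ultimately show False using free H(1) by (auto simp: induced_free_def)
qed

lemma P4_free_if_induced_free:
  assumes "induced_free \<H> G" "path_graph 4 \<in> \<H>"
  shows "P4_free (dominates G) (verts G)"
  unfolding P4_free_def
proof (intro ballI notI)
  fix a b c d assume V: "a \<in> verts G" "b \<in> verts G" "c \<in> verts G" "d \<in> verts G"
    and P4: "induced_P4 (dominates G) a b c d"
  \<comment> \<open>\<open>H\<close> is \<open>path_graph 4\<close> before \<open>with_proj\<close>,
    the form that \<open>induced_free_no_embedding\<close> expects.\<close>
  define H where "H = \<lparr>pverts = {..<4::nat},
      parcs = {(i, j). i < 4 \<and> j < 4 \<and> (j = Suc i \<or> i = Suc j)}\<rparr>"
  let ?f = "(!) [a, b, c, d]"
  have four: "{..<4::nat} = {0, 1, 2, 3}" by auto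
  show False
  proof (rule induced_free_no_embedding[OF assms(1), of H ?f])
    show "with_proj H \<in> \<H>" using assms(2) by (simp add: H_def path_graph_def)
    show "pair_wf_digraph H" by unfold_locales (auto simp: H_def)
    show "inj_on ?f (pverts H)" using P4 by (auto simp: H_def four induced_P4_def)
    show "?f ` pverts H \<subseteq> verts G" using V by (auto simp: H_def four)
    fix u v assume "u \<in> pverts H" "v \<in> pverts H"
    moreover have "\<not> x \<rightarrow>\<^bsub>G\<^esub> x" for x using irreflp_dominates by (auto simp: irreflp_def)
    moreover have "\<not> c \<rightarrow>\<^bsub>G\<^esub> a" "\<not> d \<rightarrow>\<^bsub>G\<^esub> a" "\<not> d \<rightarrow>\<^bsub>G\<^esub> b" "b \<rightarrow>\<^bsub>G\<^esub> a" "c \<rightarrow>\<^bsub>G\<^esub> b" "d \<rightarrow>\<^bsub>G\<^esub> c"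
      using P4 sympD[OF symp_dominates] unfolding induced_P4_def by blast+
    ultimately show "(u, v) \<in> parcs H \<longleftrightarrow> ?f u \<rightarrow>\<^bsub>G\<^esub> ?f v"
      using P4 unfolding induced_P4_def by (simp add: H_def four) (elim disjE; simp)
  qed
qed

text \<open>Subsets of size \<open>d\<close> of \<open>A\<close> and \<open>B\<close>, enumerated
  one after the other by \<open>f\<close>, would form an induced copy of the forbidden
  biclique.\<close>

lemma biclique_bound_if_induced_free:
  assumes free: "induced_free \<H> G" "complete_bipartite_graph d d \<in> \<H>"
    and AB: "A \<subseteq> verts G" "B \<subseteq> verts G" "indep (dominates G) A" "indep (dominates G) B"
    and complete: "\<forall>a\<in>A. \<forall>b\<in>B. a \<rightarrow>\<^bsub>G\<^esub> b"
  shows "card A < d \<or> card B < d"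
proof (rule ccontr)
  assume "\<not> (card A < d \<or> card B < d)"
  then obtain A' B' where sub: "A' \<subseteq> A" "card A' = d" "B' \<subseteq> B" "card B' = d"
    using obtain_subset_with_card_n[of d A] obtain_subset_with_card_n[of d B] by (metis not_less)
  have fin: "finite A'" "finite B'"
    using AB sub finite_subset[OF _ finite_verts] by blast+
  obtain g h where gh: "bij_betw g {0..<d} A'" "bij_betw h {0..<d} B'"
    using ex_bij_betw_nat_finite[OF fin(1)] ex_bij_betw_nat_finite[OF fin(2)] sub by auto
  have irr: "\<not> x \<rightarrow>\<^bsub>G\<^esub> x" for x using irreflp_dominates by (auto simp: irreflp_def)
  have sym: "x \<rightarrow>\<^bsub>G\<^esub> y \<Longrightarrow> y \<rightarrow>\<^bsub>G\<^esub> x" for x y using symp_dominates by (auto simp: symp_def)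
  define f where "f i = (if i < d then g i else h (i - d))" for i
  have fA: "f i \<in> A" if "i < d" for i
    using that gh(1) sub(1) by (auto simp: f_def bij_betw_def)
  have fB: "f i \<in> B" if "d \<le> i" "i < d + d" for i
    using that gh(2) sub(3) by (auto simp: f_def bij_betw_def)
  define H where "H = \<lparr>pverts = {..<d + d},
      parcs = {..<d} \<times> {d..<d + d} \<union> {d..<d + d} \<times> {..<d}\<rparr>"
  show False
  proof (rule induced_free_no_embedding[OF free(1), of H f])
    show "with_proj H \<in> \<H>" using free(2) by (simp add: H_def complete_bipartite_graph_def)
    show "pair_wf_digraph H" by unfold_locales (auto simp: H_def)
    show "f ` pverts H \<subseteq> verts G"
    proof (intro image_subsetI)
      fix i assume "i \<in> pverts H"
      then show "f i \<in> verts G"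
        using AB(1,2) fA[of i] fB[of i] by (cases "i < d") (auto simp: H_def)
    qed
    show adj: "(u, v) \<in> parcs H \<longleftrightarrow> f u \<rightarrow>\<^bsub>G\<^esub> f v" if "u \<in> pverts H" "v \<in> pverts H" for u v
      using that fA[of u] fB[of u] fA[of v] fB[of v] AB(3,4) complete sym[of "f v" "f u"]
      by (cases "u < d"; cases "v < d") (auto simp: H_def indep_def)
    show "inj_on f (pverts H)"
    proof (rule inj_onI)
      fix u v assume uv: "u \<in> pverts H" "v \<in> pverts H" "f u = f v"
      \<comment> \<open>A common image of indices from different sides would be adjacent to itself.
        So disjointness of \<open>A\<close> and \<open>B\<close> follows from the absence of
        loops.\<close>
      then have "u < d \<longleftrightarrow> v < d"
        using adj[of u v] irr[of "f u"] by (auto simp: H_def)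
      then consider "u < d" "v < d" | "d \<le> u" "d \<le> v" by linarith
      then show "u = v"
      proof cases
        case 1
        then show ?thesis using uv(3) gh(1) by (auto simp: f_def bij_betw_def dest: inj_onD)
      next
        case 2
        then have "u - d = v - d"
          using uv gh(2) by (auto simp: H_def f_def bij_betw_def intro: inj_onD)
        then show ?thesis using 2 by linarith
      qed
    qed
  qed
qed

lemma tree_decomposition_if_parent_decomposition:
  assumes D: "parent_decomposition (dominates G) (verts G) k n p \<beta>"
  shows "tree_decomposition G (with_proj (parent_graph {..<n} p)) \<beta>" (is "tree_decomposition G ?T \<beta>")
proof -
  have D': "0 < n" "\<And>t. t < n \<Longrightarrow> 0 < t \<Longrightarrow> p t < t" "\<And>t. t < n \<Longrightarrow> \<beta> t \<subseteq> verts G"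
    "\<And>u v. u \<in> verts G \<Longrightarrow> v \<in> verts G \<Longrightarrow> u \<rightarrow>\<^bsub>G\<^esub> v \<Longrightarrow> \<exists>t<n. u \<in> \<beta> t \<and> v \<in> \<beta> t"
    "\<And>v. v \<in> verts G \<Longrightarrow> \<exists>s<n. v \<in> \<beta> s \<and> (\<forall>t<n. v \<in> \<beta> t \<longrightarrow> t \<noteq> s \<longrightarrow> p t < t \<and> v \<in> \<beta> (p t))"
    using D by (simp_all add: parent_decomposition_def)
  have verts_T: "verts ?T = {..<n}" by (simp add: parent_graph_def)
  have "p t < n \<and> p t < t" if "t < n" "t \<noteq> 0" for t
    using D'(2)[of t] that by auto
  then have "is_tree ?T"
    using D'(1) by (intro is_tree_parent_graph[of _ 0]) auto
  moreover have "is_tree (?T \<restriction> {t \<in> verts ?T. v \<in> \<beta> t})" if v: "v \<in> verts G" for v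
  proof -
    obtain s where s: "s < n" "v \<in> \<beta> s"
      "\<And>t. t < n \<Longrightarrow> v \<in> \<beta> t \<Longrightarrow> t \<noteq> s \<Longrightarrow> p t < t \<and> v \<in> \<beta> (p t)"
      using D'(5)[OF v] by blast
    \<comment> \<open>The nodes whose bags contain \<open>v\<close> form a parent graph for the same
      \<open>p\<close>, rooted at the top node \<open>s\<close>.\<close>
    have "is_tree (with_proj (parent_graph {t \<in> {..<n}. v \<in> \<beta> t} p))"
      using s by (intro is_tree_parent_graph[of _ s]) fastforce+
    then show ?thesis
      unfolding verts_T by (subst induce_subgraph_parent_graph) auto
  qed
  moreover have "\<exists>t<n. u \<in> \<beta> t \<and> v \<in> \<beta> t" if "u \<rightarrow>\<^bsub>G\<^esub> v" for u v
    using D'(4)[OF adj_in_verts[OF that] that] .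
  moreover have "\<exists>t<n. v \<in> \<beta> t" if "v \<in> verts G" for v
    using D'(5)[OF that] by blast
  ultimately show ?thesis
    unfolding tree_decomposition_def using D'(3) verts_T by (auto simp: Bex_def)
qed

lemma decomposition_independence_number_le:
  assumes D: "parent_decomposition (dominates G) (verts G) k n p \<beta>"
  shows "decomposition_independence_number G (with_proj (parent_graph {..<n} p)) \<beta> \<le> k"
proof -
  have D': "0 < n" "\<And>t. t < n \<Longrightarrow> \<beta> t \<subseteq> verts G"
    "\<And>t S. t < n \<Longrightarrow> S \<subseteq> \<beta> t \<Longrightarrow> indep (dominates G) S \<Longrightarrow> card S \<le> k"
    using D by (simp_all add: parent_decomposition_def)
  have "independence_number (G \<restriction> \<beta> t) \<le> k" if t: "t < n" for t
  proof -
    have "S \<subseteq> \<beta> t \<and> indep (dominates G) S" if "independent_set (G \<restriction> \<beta> t) S" for S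
    proof -
      have S: "S \<subseteq> \<beta> t" "\<forall>u\<in>S. \<forall>v\<in>S. \<not> u \<rightarrow>\<^bsub>G \<restriction> \<beta> t\<^esub> v"
        using that by (auto simp: independent_set_def)
      \<comment> \<open>Inside a bag the induced subgraph keeps all arcs of \<open>G\<close>, so
        independence there is independence in \<open>G\<close>.\<close>
      have "u \<rightarrow>\<^bsub>G \<restriction> \<beta> t\<^esub> v" if "u \<in> S" "v \<in> S" "u \<rightarrow>\<^bsub>G\<^esub> v" for u v
        using that S(1) by (force simp: arcs_ends_conv)
      then show ?thesis using S by (auto simp: indep_def)
    qed
    moreover have "finite (\<beta> t)" using D'(2)[OF t] finite_verts by (rule finite_subset)
    \<comment> \<open>The empty set ensures that the maximum is taken over a nonempty set, even for
      an empty bag.\<close>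
    moreover have "independent_set (G \<restriction> \<beta> t) {}" by (simp add: independent_set_def)
    ultimately show ?thesis
      unfolding independence_number_def using D'(3)[OF t]
      by (subst Max_le_iff) (auto intro!: finite_imageI intro: finite_subset[of _ "Pow (\<beta> t)"])
  qed
  then show ?thesis
    unfolding decomposition_independence_number_def using D'(1)
    by (subst Max_le_iff) (auto simp: parent_graph_def)
qed

end

theorem theorem1p7:
  fixes d :: nat and G :: "('a, 'b) pre_digraph"
  assumes "2 \<le> d"
    and "graph G"
    and "induced_free {complete_bipartite_graph d d, path_graph 4} G"
  shows "tree_alpha G \<le> d - 1"
proof -
  interpret graph G by fact
  have "card A \<le> d - 1 \<or> card B \<le> d - 1"
    if "A \<subseteq> verts G" "B \<subseteq> verts G" "indep (dominates G) A" "indep (dominates G) B"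
      "\<forall>a\<in>A. \<forall>b\<in>B. a \<rightarrow>\<^bsub>G\<^esub> b" for A B
    using biclique_bound_if_induced_free[OF assms(3) _ that] by fastforce
  moreover have "P4_free (dominates G) (verts G)"
    by (rule P4_free_if_induced_free[OF assms(3)]) simp
  moreover have "1 \<le> d - 1" using assms(1) by simp
  ultimately have "\<exists>n p \<beta>. parent_decomposition (dominates G) (verts G) (d - 1) n p \<beta>"
    by (intro exists_parent_decomposition[OF symp_dominates irreflp_dominates]) auto
  then obtain n p \<beta> where D: "parent_decomposition (dominates G) (verts G) (d - 1) n p \<beta>"
    by blast
  \<comment> \<open>\<open>tree_alpha\<close> is a least value, so this one decomposition bounds it
    from above.\<close>
  have "tree_alpha G \<le> decomposition_independence_number G (with_proj (parent_graph {..<n} p)) \<beta>"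
    unfolding tree_alpha_def
    by (rule Least_le, intro exI conjI, rule tree_decomposition_if_parent_decomposition[OF D], rule refl)
  then show ?thesis
    using decomposition_independence_number_le[OF D] by linarith
qed

end
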